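(* Let $\mathsf{W}$ be a weak equivalence set on a finite lattice $P$. Then $\mathsf{AF}_{max}=T_{max}$ and $\mathsf{AC}_{max}=K_{max}$.
   Context: A finite lattice $P$ is regarded as a category whose objects are the elements of $P$, with a unique arrow $a\to b$ whenever $a\le b$. A wide subcategory is one containing all objects; a subcategory $D$ of $P$ is decomposable if whenever $f,g$ are composable morphisms of $P$ with $g\circ f\in D$, then $f\in D$ and $g\in D$. Wide subcategories are identified with their collections of morphisms. A transfer system on $P$ is a partial order $R$ on the set $P$ such that $xRy$ implies $x\le y$, and $xRy$, $z\le y$ imply $(x\wedge z)Rz$; equivalently, a wide subcategory of $P$ closed under pullbacks. A cotransfer system on $P$ is a partial order $R$ such that $xRy$ implies $x\le y$, and $xRy$, $x\le z$ imply $zR(y\vee z)$; equivalently, a wide subcategory closed under pushouts. Ordered by inclusion, transfer systems form a lattice $\mathrm{Tr}(P)$ and cotransfer systems a lattice $\mathrm{CoTr}(P)$: meets are intersections, and joins are the smallest (co)transfer systems containing the union. For arrows $i\colon a\to b$ and $p\colon x\to y$, $i$ has the left lifting property with respect to $p$ (and $p$ the right lifting property with respect to $i$) if every commutative square from $i$ to $p$ has a diagonal lift $b\to x$. A weak factorization system on $P$ is a pair $(L,R)$ of classes of morphisms such that every morphism factors as $p\circ i$ with $i\in L$, $p\in R$; $L$ is the class of all morphisms with the left lifting property against all of $R$; and $R$ is the class of all morphisms with the right lifting property against all of $L$. A model structure on $P$ consists of two weak factorization systems $(\mathsf{AC},\mathsf{F})$ and $(\mathsf{C},\mathsf{AF})$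 with $\mathsf{AC}\subseteq\mathsf{C}$ such that $\mathsf{W}:=\mathsf{AF}\circ\mathsf{AC}=\{p\circ i: i\in\mathsf{AC},\,p\in\mathsf{AF}\}$ (the weak equivalences) satisfies the two-out-of-three axiom; $\mathsf{AF}$ are the acyclic fibrations and $\mathsf{AC}$ the acyclic cofibrations. A wide decomposable subcategory $\mathsf{W}$ of $P$ is a weak equivalence set if there is a model structure on $P$ with weak equivalences $\mathsf{W}$. $\mathrm{AF}(\mathsf{W})$ (resp. $\mathrm{AC}(\mathsf{W})$) is the set of transfer systems (resp. cotransfer systems) contained in $\mathsf{W}$ that form the acyclic fibrations (resp. acyclic cofibrations) of a model structure on $P$ with weak equivalences $\mathsf{W}$. $\mathsf{AF}_{max}$ is the join of all elements of $\mathrm{AF}(\mathsf{W})$; $\mathsf{AC}_{max}$ is the join of all elements of $\mathrm{AC}(\mathsf{W})$. $T_{max}$ is the join of all transfer systems on $P$ contained in $\mathsf{W}$, and $K_{max}$ is the join of all cotransfer systems on $P$ contained in $\mathsf{W}$. *)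

theory Defs
  imports Main "HOL.Hull"
begin

text \<open>
  A finite lattice is a type of class \<open>{finite, lattice}\<close>, viewed as a category. An arrow from
  \<open>a\<close> to \<open>b\<close> is the pair \<open>(a, b)\<close> with \<open>a \<le> b\<close>, and a wide subcategory is its set of arrows,
  identities \<open>(a, a)\<close> included.
\<close>

definition arrows :: "'a::order rel" where
  "arrows = {(a, b). a \<le> b}"

definition wide_subcategory :: "'a::order rel \<Rightarrow> bool" where
  "wide_subcategory D \<longleftrightarrow> D \<subseteq> arrows \<and> refl D \<and> trans D"

definition decomposable :: "'a::order rel \<Rightarrow> bool" where
  "decomposable D \<longleftrightarrow>
    (\<forall>a b c. (a, b) \<in> arrows \<longrightarrow> (b, c) \<in> arrows \<longrightarrow> (a, c) \<in> D \<longrightarrow> (a, b) \<in> D \<and> (b, c) \<in> D)"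

definition transfer_system :: "'a::lattice rel \<Rightarrow> bool" where
  "transfer_system R \<longleftrightarrow> partial_order_on UNIV R \<and> (\<forall>x y. (x, y) \<in> R \<longrightarrow> x \<le> y) \<and>
    (\<forall>x y z. (x, y) \<in> R \<longrightarrow> z \<le> y \<longrightarrow> (inf x z, z) \<in> R)"

definition cotransfer_system :: "'a::lattice rel \<Rightarrow> bool" where
  "cotransfer_system R \<longleftrightarrow> partial_order_on UNIV R \<and> (\<forall>x y. (x, y) \<in> R \<longrightarrow> x \<le> y) \<and>
    (\<forall>x y z. (x, y) \<in> R \<longrightarrow> x \<le> z \<longrightarrow> (z, sup y z) \<in> R)"

text \<open>
  The hull intersects all (co)transfer systems that contain the union. It is itself one when
  \<open>S\<close> consists of (co)transfer systems, so it is their join; see the two lemmas below.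
\<close>

definition transfer_join :: "'a::lattice rel set \<Rightarrow> 'a rel" where
  "transfer_join S = transfer_system hull (\<Union>S)"

definition cotransfer_join :: "'a::lattice rel set \<Rightarrow> 'a rel" where
  "cotransfer_join S = cotransfer_system hull (\<Union>S)"

lemma transfer_system_transfer_join:
  fixes S :: "'a::lattice rel set"
  assumes "\<forall>T\<in>S. transfer_system T"
  shows "transfer_system (transfer_join S)"
proof -
  have "transfer_system (arrows :: 'a rel)"
    by (auto simp: transfer_system_def arrows_def partial_order_on_def preorder_on_def
        refl_on_def trans_def antisym_def)
  moreover have "\<Union>S \<subseteq> arrows"
    using assms by (fastforce simp: transfer_system_def arrows_def)
  ultimately have "transfer_join S \<subseteq> arrows"
    unfolding transfer_join_def by (rule hull_minimal[rotated])
  then have le: "x \<le> y" if "(x, y) \<in> transfer_join S" for x y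
    using that by (auto simp: arrows_def)
  then have "antisym (transfer_join S)"
    by (intro antisymI order.antisym)
  moreover have "refl (transfer_join S)"
    by (auto simp: transfer_join_def hull_def transfer_system_def partial_order_on_def
        preorder_on_def refl_on_def)
  moreover have "trans (transfer_join S)"
    by (rule transI) (auto simp: transfer_join_def hull_def transfer_system_def partial_order_on_def
        preorder_on_def elim: transE)
  moreover have "\<forall>x y z. (x, y) \<in> transfer_join S \<longrightarrow> z \<le> y \<longrightarrow> (inf x z, z) \<in> transfer_join S"
    unfolding transfer_join_def hull_def by (auto simp: transfer_system_def)
  ultimately show ?thesis
    using le by (simp add: transfer_system_def partial_order_on_def preorder_on_def)
qed

lemma cotransfer_system_cotransfer_join:
  fixes S :: "'a::lattice rel set"
  assumes "\<forall>T\<in>S. cotransfer_system T"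
  shows "cotransfer_system (cotransfer_join S)"
proof -
  have "cotransfer_system (arrows :: 'a rel)"
    by (auto simp: cotransfer_system_def arrows_def partial_order_on_def preorder_on_def
        refl_on_def trans_def antisym_def)
  moreover have "\<Union>S \<subseteq> arrows"
    using assms by (fastforce simp: cotransfer_system_def arrows_def)
  ultimately have "cotransfer_join S \<subseteq> arrows"
    unfolding cotransfer_join_def by (rule hull_minimal[rotated])
  then have le: "x \<le> y" if "(x, y) \<in> cotransfer_join S" for x y
    using that by (auto simp: arrows_def)
  then have "antisym (cotransfer_join S)"
    by (intro antisymI order.antisym)
  moreover have "refl (cotransfer_join S)"
    by (auto simp: cotransfer_join_def hull_def cotransfer_system_def partial_order_on_def
        preorder_on_def refl_on_def)
  moreover have "trans (cotransfer_join S)"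
    by (rule transI) (auto simp: cotransfer_join_def hull_def cotransfer_system_def partial_order_on_def
        preorder_on_def elim: transE)
  moreover have "\<forall>x y z. (x, y) \<in> cotransfer_join S \<longrightarrow> x \<le> z \<longrightarrow> (z, sup y z) \<in> cotransfer_join S"
    unfolding cotransfer_join_def hull_def by (auto simp: cotransfer_system_def)
  ultimately show ?thesis
    using le by (simp add: cotransfer_system_def partial_order_on_def preorder_on_def)
qed

text \<open>
  A commutative square from \<open>a \<rightarrow> b\<close> to \<open>x \<rightarrow> y\<close> amounts to arrows \<open>a \<rightarrow> x\<close> and \<open>b \<rightarrow> y\<close>, and a
  diagonal lift to an arrow \<open>b \<rightarrow> x\<close>, since all diagrams in a poset commute.
\<close>

definition lifts_against :: "'a::order \<times> 'a \<Rightarrow> 'a \<times> 'a \<Rightarrow> bool" where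
  "lifts_against i p \<longleftrightarrow>
    (case i of (a, b) \<Rightarrow> case p of (x, y) \<Rightarrow>
      (a, x) \<in> arrows \<and> (b, y) \<in> arrows \<longrightarrow> (b, x) \<in> arrows)"

text \<open>
  Relational composition is diagrammatic: \<open>L O R\<close> is the class of composites \<open>p \<circ> i\<close> with
  \<open>i \<in> L\<close> and \<open>p \<in> R\<close>.
\<close>

definition weak_factorization_system :: "'a::order rel \<Rightarrow> 'a rel \<Rightarrow> bool" where
  "weak_factorization_system L R \<longleftrightarrow> L \<subseteq> arrows \<and> R \<subseteq> arrows \<and> arrows \<subseteq> L O R \<and>
    L = {i \<in> arrows. \<forall>p\<in>R. lifts_against i p} \<and>
    R = {p \<in> arrows. \<forall>i\<in>L. lifts_against i p}"

definition two_out_of_three :: "'a::order rel \<Rightarrow> bool" where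
  "two_out_of_three W \<longleftrightarrow> (\<forall>a b c. (a, b) \<in> arrows \<longrightarrow> (b, c) \<in> arrows \<longrightarrow>
    ((a, b) \<in> W \<and> (b, c) \<in> W \<longrightarrow> (a, c) \<in> W) \<and>
    ((a, b) \<in> W \<and> (a, c) \<in> W \<longrightarrow> (b, c) \<in> W) \<and>
    ((b, c) \<in> W \<and> (a, c) \<in> W \<longrightarrow> (a, b) \<in> W))"

definition model_structure :: "'a::order rel \<Rightarrow> 'a rel \<Rightarrow> 'a rel \<Rightarrow> 'a rel \<Rightarrow> bool" where
  "model_structure AC F C AF \<longleftrightarrow>
    weak_factorization_system AC F \<and> weak_factorization_system C AF \<and>
    AC \<subseteq> C \<and> two_out_of_three (AC O AF)"

definition weak_equivalence_set :: "'a::order rel \<Rightarrow> bool" where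
  "weak_equivalence_set W \<longleftrightarrow> wide_subcategory W \<and> decomposable W \<and>
    (\<exists>AC F C AF. model_structure AC F C AF \<and> W = AC O AF)"

definition AF_set :: "'a::lattice rel \<Rightarrow> 'a rel set" where
  "AF_set W = {AF. transfer_system AF \<and> AF \<subseteq> W \<and>
    (\<exists>AC F C. model_structure AC F C AF \<and> W = AC O AF)}"

definition AC_set :: "'a::lattice rel \<Rightarrow> 'a rel set" where
  "AC_set W = {AC. cotransfer_system AC \<and> AC \<subseteq> W \<and>
    (\<exists>F C AF. model_structure AC F C AF \<and> W = AC O AF)}"

definition AF_max :: "'a::lattice rel \<Rightarrow> 'a rel" where
  "AF_max W = transfer_join (AF_set W)"

definition AC_max :: "'a::lattice rel \<Rightarrow> 'a rel" where
  "AC_max W = cotransfer_join (AC_set W)"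

definition T_max :: "'a::lattice rel \<Rightarrow> 'a rel" where
  "T_max W = transfer_join {T. transfer_system T \<and> T \<subseteq> W}"

definition K_max :: "'a::lattice rel \<Rightarrow> 'a rel" where
  "K_max W = cotransfer_join {K. cotransfer_system K \<and> K \<subseteq> W}"

end

theory Submission
  imports Defs
begin

text \<open>
  The weak equivalence set \<open>W\<close> contains a largest transfer system \<open>T\<close>: the arrows all of whose
  pullbacks lie in \<open>W\<close>. It suffices to show that \<open>T\<close> is itself the class of acyclic fibrations of
  a model structure with weak equivalences \<open>W\<close>, since then the join over the smaller family
  \<open>AF_set W\<close> already contains \<open>T\<close>.

  More generally, start from a model structure \<open>(AC, F, C, AF)\<close> with weak equivalences \<open>W\<close> and enlarge
  \<open>AF\<close> to any transfer system \<open>T\<close> with \<open>AF \<subseteq> T \<subseteq> W\<close>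
  (\<open>enlarge_acyclic_fibrations\<close>). The new cofibrations \<open>C'\<close> are the arrows that lift
  against \<open>T\<close>, and the new acyclic cofibrations have to be \<open>AC' = C' \<inter> W\<close>. Two
  points need an argument.

  First, \<open>W = AC' O T\<close>: on a finite lattice every transfer system is the right class of a weak
  factorization system, so an arrow of \<open>W\<close> factors through \<open>C'\<close> followed by \<open>T\<close>, and
  decomposability of \<open>W\<close> puts the first factor into \<open>W\<close>.

  Second, \<open>AC'\<close> is closed under pushouts, although \<open>W\<close> need not be. Here the old model
  structure is used: \<open>AF \<subseteq> T\<close> gives \<open>C' \<subseteq> C\<close>, hence
  \<open>AC' \<subseteq> C \<inter> W = AC\<close>, and pushouts of arrows of \<open>AC\<close> stay in \<open>AC \<subseteq> W\<close>. So
  \<open>AC'\<close> is a cotransfer system and, again by finiteness, the left class of a weak factorization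
  system.

  The statement about \<open>AC_max\<close> is the order dual.
\<close>

section \<open>Lifting classes and transfer systems\<close>

definition left_lifting :: "'a::order rel \<Rightarrow> 'a rel" where
  "left_lifting R = {i \<in> arrows. \<forall>p\<in>R. lifts_against i p}"

definition right_lifting :: "'a::order rel \<Rightarrow> 'a rel" where
  "right_lifting L = {p \<in> arrows. \<forall>i\<in>L. lifts_against i p}"

lemma in_left_lifting:
  "(a, b) \<in> left_lifting R \<longleftrightarrow> a \<le> b \<and> (\<forall>x y. (x, y) \<in> R \<longrightarrow> a \<le> x \<longrightarrow> b \<le> y \<longrightarrow> b \<le> x)"
  by (auto simp: left_lifting_def lifts_against_def arrows_def)

lemma in_right_lifting:
  "(x, y) \<in> right_lifting L \<longleftrightarrow> x \<le> y \<and> (\<forall>a b. (a, b) \<in> L \<longrightarrow> a \<le> x \<longrightarrow> b \<le> y \<longrightarrow> b \<le> x)"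
  by (auto simp: right_lifting_def lifts_against_def arrows_def)

lemma weak_factorization_system_iff:
  "weak_factorization_system L R \<longleftrightarrow>
    arrows \<subseteq> L O R \<and> L = left_lifting R \<and> R = right_lifting L"
  unfolding weak_factorization_system_def left_lifting_def right_lifting_def by blast

lemma weak_factorization_systemD:
  assumes "weak_factorization_system L R"
  shows "L = left_lifting R" and "R = right_lifting L"
    and "\<And>a b. a \<le> b \<Longrightarrow> \<exists>x. (a, x) \<in> L \<and> (x, b) \<in> R"
  using assms unfolding weak_factorization_system_iff arrows_def by blast+

lemma transfer_system_iff:
  fixes R :: "'a::lattice rel"
  shows "transfer_system R \<longleftrightarrow> wide_subcategory R \<and>
    (\<forall>x y z. (x, y) \<in> R \<longrightarrow> z \<le> y \<longrightarrow> (inf x z, z) \<in> R)"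
  by (auto simp: transfer_system_def wide_subcategory_def partial_order_on_def preorder_on_def
      arrows_def intro!: antisymI intro: order.antisym)

lemma cotransfer_system_iff:
  fixes R :: "'a::lattice rel"
  shows "cotransfer_system R \<longleftrightarrow> wide_subcategory R \<and>
    (\<forall>x y z. (x, y) \<in> R \<longrightarrow> x \<le> z \<longrightarrow> (z, sup y z) \<in> R)"
  by (auto simp: cotransfer_system_def wide_subcategory_def partial_order_on_def preorder_on_def
      arrows_def intro!: antisymI intro: order.antisym)

lemma wide_subcategory_Int:
  assumes "wide_subcategory A" and "wide_subcategory B"
  shows "wide_subcategory (A \<inter> B)"
  using assms by (auto simp: wide_subcategory_def refl_on_def intro: trans_Int)

lemma cotransfer_system_left_lifting:
  fixes R :: "'a::lattice rel"
  shows "cotransfer_system (left_lifting R)"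
proof -
  have "trans (left_lifting R)"
    by (rule transI, unfold in_left_lifting) (meson order.trans)
  then show ?thesis
    by (auto simp: cotransfer_system_iff wide_subcategory_def refl_on_def in_left_lifting arrows_def)
qed

lemma transfer_system_right_lifting:
  fixes L :: "'a::lattice rel"
  shows "transfer_system (right_lifting L)"
proof -
  have "trans (right_lifting L)"
    by (rule transI, unfold in_right_lifting) (meson order.trans)
  then show ?thesis
    by (auto simp: transfer_system_iff wide_subcategory_def refl_on_def in_right_lifting arrows_def)
qed

text \<open>
  To factor \<open>a \<le> b\<close>, take a minimal \<open>x\<close> above \<open>a\<close> with an arrow of \<open>T\<close> to \<open>b\<close>. Pulling
  back an arrow of \<open>T\<close> along \<open>x\<close> and composing with \<open>x \<rightarrow> b\<close> yields a competitor below
  \<open>x\<close>, so minimality produces the lifts for \<open>a \<rightarrow> x\<close>.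
\<close>

lemma weak_factorization_system_of_transfer_system:
  fixes T :: "'a::{finite, lattice} rel"
  assumes T: "transfer_system T"
  shows "weak_factorization_system (left_lifting T) T"
proof -
  have sub: "T \<subseteq> arrows" and "refl T" and "trans T"
    and pullback: "\<And>x y z. (x, y) \<in> T \<Longrightarrow> z \<le> y \<Longrightarrow> (inf x z, z) \<in> T"
    using T by (auto simp: transfer_system_iff wide_subcategory_def)
  have factor: "\<exists>x. (a, x) \<in> left_lifting T \<and> (x, b) \<in> T" if "a \<le> b" for a b
  proof -
    have "b \<in> {x. a \<le> x \<and> (x, b) \<in> T}"
      using \<open>a \<le> b\<close> \<open>refl T\<close> by (auto dest: refl_onD)
    then obtain x where x: "a \<le> x" "(x, b) \<in> T"
      and minimal: "\<And>y. a \<le> y \<Longrightarrow> (y, b) \<in> T \<Longrightarrow> y \<le> x \<Longrightarrow> x = y"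
      using finite_has_minimal[of "{x. a \<le> x \<and> (x, b) \<in> T}"] by fastforce
    have "x \<le> u" if "(u, v) \<in> T" "a \<le> u" "x \<le> v" for u v
    proof -
      have "(inf u x, b) \<in> T"
        using pullback[OF that(1,3)] x(2) \<open>trans T\<close> by (meson transD)
      then have "x = inf u x"
        using minimal \<open>a \<le> u\<close> x(1) by simp
      then show ?thesis
        by (metis inf_le1)
    qed
    then show ?thesis
      using x by (auto simp: in_left_lifting)
  qed
  have "T = right_lifting (left_lifting T)"
  proof
    show "T \<subseteq> right_lifting (left_lifting T)"
      using sub by (auto simp: in_right_lifting in_left_lifting arrows_def)
  next
    \<comment> \<open>Retract argument: lifting the first factor of \<open>p\<close> against \<open>p\<close> makes that factor an identity.\<close>
    show "right_lifting (left_lifting T) \<subseteq> T"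
    proof clarify
      fix a b assume ab: "(a, b) \<in> right_lifting (left_lifting T)"
      then have "a \<le> b"
        by (simp add: in_right_lifting)
      then obtain x where x: "(a, x) \<in> left_lifting T" "(x, b) \<in> T"
        using factor by blast
      moreover have "x \<le> b"
        using x(2) sub by (auto simp: arrows_def)
      ultimately have "x \<le> a" "a \<le> x"
        using ab by (auto simp: in_right_lifting in_left_lifting)
      then show "(a, b) \<in> T"
        using x(2) by simp
    qed
  qed
  then show ?thesis
    using factor by (fastforce simp: weak_factorization_system_iff arrows_def)
qed

lemma weak_factorization_system_of_cotransfer_system:
  fixes K :: "'a::{finite, lattice} rel"
  assumes K: "cotransfer_system K"
  shows "weak_factorization_system K (right_lifting K)"
proof -
  have sub: "K \<subseteq> arrows" and "refl K" and "trans K"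
    and pushout: "\<And>x y z. (x, y) \<in> K \<Longrightarrow> x \<le> z \<Longrightarrow> (z, sup y z) \<in> K"
    using K by (auto simp: cotransfer_system_iff wide_subcategory_def)
  have factor: "\<exists>x. (a, x) \<in> K \<and> (x, b) \<in> right_lifting K" if "a \<le> b" for a b
  proof -
    have "a \<in> {x. x \<le> b \<and> (a, x) \<in> K}"
      using \<open>a \<le> b\<close> \<open>refl K\<close> by (auto dest: refl_onD)
    then obtain x where x: "x \<le> b" "(a, x) \<in> K"
      and maximal: "\<And>y. y \<le> b \<Longrightarrow> (a, y) \<in> K \<Longrightarrow> x \<le> y \<Longrightarrow> x = y"
      using finite_has_maximal[of "{x. x \<le> b \<and> (a, x) \<in> K}"] by fastforce
    have "v \<le> x" if "(u, v) \<in> K" "u \<le> x" "v \<le> b" for u v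
    proof -
      have "(a, sup v x) \<in> K"
        using pushout[OF that(1,2)] x(2) \<open>trans K\<close> by (meson transD)
      then have "x = sup v x"
        using maximal \<open>v \<le> b\<close> x(1) by simp
      then show ?thesis
        by (metis sup_ge1)
    qed
    then show ?thesis
      using x by (auto simp: in_right_lifting)
  qed
  have "K = left_lifting (right_lifting K)"
  proof
    show "K \<subseteq> left_lifting (right_lifting K)"
      using sub by (auto simp: in_right_lifting in_left_lifting arrows_def)
  next
    show "left_lifting (right_lifting K) \<subseteq> K"
    proof clarify
      fix a b assume ab: "(a, b) \<in> left_lifting (right_lifting K)"
      then have "a \<le> b"
        by (simp add: in_left_lifting)
      then obtain x where x: "(a, x) \<in> K" "(x, b) \<in> right_lifting K"
        using factor by blast
      moreover have "a \<le> x"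
        using x(1) sub by (auto simp: arrows_def)
      ultimately have "x = b"
        using ab by (auto simp: in_right_lifting in_left_lifting intro: order.antisym)
      then show "(a, b) \<in> K"
        using x(1) by simp
    qed
  qed
  then show ?thesis
    using factor by (fastforce simp: weak_factorization_system_iff arrows_def)
qed

section \<open>Enlarging the acyclic part of a model structure\<close>

text \<open>
  Retract arguments again: a cofibration that factors as an acyclic cofibration followed by an
  acyclic fibration \<open>p\<close> lifts against \<open>p\<close>, so \<open>p\<close> is an identity.
\<close>

lemma acyclic_cofibration_if_lifts:
  assumes "(a, b) \<in> left_lifting AF" and "(a, b) \<in> AC O AF" and "AC \<subseteq> arrows" and "AF \<subseteq> arrows"
  shows "(a, b) \<in> AC"
proof -
  obtain x where x: "(a, x) \<in> AC" "(x, b) \<in> AF"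
    using assms(2) by blast
  then have "a \<le> x" "x \<le> b"
    using assms(3,4) by (auto simp: arrows_def)
  then have "x = b"
    using assms(1) x(2) by (auto simp: in_left_lifting intro: order.antisym)
  then show ?thesis
    using x(1) by simp
qed

lemma acyclic_fibration_if_lifts:
  assumes "(a, b) \<in> right_lifting AC" and "(a, b) \<in> AC O AF" and "AC \<subseteq> arrows" and "AF \<subseteq> arrows"
  shows "(a, b) \<in> AF"
proof -
  obtain x where x: "(a, x) \<in> AC" "(x, b) \<in> AF"
    using assms(2) by blast
  then have "a \<le> x" "x \<le> b"
    using assms(3,4) by (auto simp: arrows_def)
  then have "x = a"
    using assms(1) x(1) by (auto simp: in_right_lifting intro: order.antisym)
  then show ?thesis
    using x(2) by simp
qed

lemma model_structure_systems:
  fixes AC :: "'a::lattice rel"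
  assumes "model_structure AC F C AF"
  shows "cotransfer_system AC" and "transfer_system AF" and "AC \<subseteq> AC O AF" and "AF \<subseteq> AC O AF"
proof -
  have "AC = left_lifting F" "AF = right_lifting C"
    using assms weak_factorization_systemD unfolding model_structure_def by blast+
  then show AC: "cotransfer_system AC" and AF: "transfer_system AF"
    by (metis cotransfer_system_left_lifting, metis transfer_system_right_lifting)
  have "Id \<subseteq> AC" "Id \<subseteq> AF"
    using AC AF
    by (auto simp: cotransfer_system_iff transfer_system_iff wide_subcategory_def refl_on_def)
  then show "AC \<subseteq> AC O AF" "AF \<subseteq> AC O AF"
    by auto
qed

text \<open>
  The cofibrations are forced to be \<open>C' = left_lifting T\<close> and the acyclic ones \<open>C' \<inter> W\<close>. Membership
  in \<open>W\<close> is not stable under pushout; the inclusion \<open>C' \<inter> W \<subseteq> AC\<close> makes it so on \<open>C' \<inter> W\<close>.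
\<close>

lemma enlarge_acyclic_fibrations:
  fixes W :: "'a::{finite, lattice} rel"
  assumes W: "wide_subcategory W" "decomposable W"
    and M: "model_structure AC F C AF" and WM: "W = AC O AF"
    and T: "transfer_system T" "AF \<subseteq> T" "T \<subseteq> W"
  shows "T \<in> AF_set W"
proof -
  define AC' where "AC' = left_lifting T \<inter> W"
  have AC: "cotransfer_system AC" "AC \<subseteq> W" and sub: "AC \<subseteq> arrows" "AF \<subseteq> arrows"
    using model_structure_systems[OF M] WM
    by (auto simp: cotransfer_system_iff transfer_system_iff wide_subcategory_def)
  have factorT: "weak_factorization_system (left_lifting T) T"
    using T(1) by (rule weak_factorization_system_of_transfer_system)
  have "left_lifting T \<subseteq> left_lifting AF"
    using T(2) by (auto simp: left_lifting_def)
  then have "AC' \<subseteq> AC"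
    using acyclic_cofibration_if_lifts[OF _ _ sub] WM by (auto simp: AC'_def)
  then have "(z, sup y z) \<in> AC'" if "(x, y) \<in> AC'" "x \<le> z" for x y z
    using that AC cotransfer_system_left_lifting[of T]
    unfolding AC'_def cotransfer_system_iff by blast
  moreover have "wide_subcategory AC'"
    using cotransfer_system_left_lifting[of T] W(1)
    by (auto simp: AC'_def cotransfer_system_iff intro: wide_subcategory_Int)
  ultimately have "weak_factorization_system AC' (right_lifting AC')"
    by (intro weak_factorization_system_of_cotransfer_system) (auto simp: cotransfer_system_iff)
  moreover have W_eq: "W = AC' O T"
  proof
    show "AC' O T \<subseteq> W"
      using W(1) T(3) by (auto simp: AC'_def wide_subcategory_def dest: transD)
    show "W \<subseteq> AC' O T"
    proof clarify
      fix a b assume ab: "(a, b) \<in> W"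
      then obtain x where x: "(a, x) \<in> left_lifting T" "(x, b) \<in> T"
        using weak_factorization_systemD(3)[OF factorT, of a b] W(1)
        by (auto simp: wide_subcategory_def arrows_def)
      moreover have "(x, b) \<in> arrows"
        using x(2) T(1) by (auto simp: transfer_system_iff wide_subcategory_def)
      ultimately have "(a, x) \<in> W"
        using W(2) ab by (auto simp: decomposable_def left_lifting_def)
      then show "(a, b) \<in> AC' O T"
        using x by (auto simp: AC'_def)
    qed
  qed
  moreover have "two_out_of_three (AC' O T)"
    using M WM by (simp add: model_structure_def flip: W_eq)
  moreover have "AC' \<subseteq> left_lifting T"
    by (auto simp: AC'_def)
  ultimately have "model_structure AC' (right_lifting AC') (left_lifting T) T"
    using factorT unfolding model_structure_def by blast
  then show ?thesis
    using T(1,3) W_eq unfolding AF_set_def by blast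
qed

lemma enlarge_acyclic_cofibrations:
  fixes W :: "'a::{finite, lattice} rel"
  assumes W: "wide_subcategory W" "decomposable W"
    and M: "model_structure AC F C AF" and WM: "W = AC O AF"
    and K: "cotransfer_system K" "AC \<subseteq> K" "K \<subseteq> W"
  shows "K \<in> AC_set W"
proof -
  define AF' where "AF' = right_lifting K \<inter> W"
  have AF: "transfer_system AF" "AF \<subseteq> W" and sub: "AC \<subseteq> arrows" "AF \<subseteq> arrows"
    using model_structure_systems[OF M] WM
    by (auto simp: cotransfer_system_iff transfer_system_iff wide_subcategory_def)
  have factorK: "weak_factorization_system K (right_lifting K)"
    using K(1) by (rule weak_factorization_system_of_cotransfer_system)
  have "right_lifting K \<subseteq> right_lifting AC"
    using K(2) by (auto simp: right_lifting_def)
  then have "AF' \<subseteq> AF"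
    using acyclic_fibration_if_lifts[OF _ _ sub] WM by (auto simp: AF'_def)
  then have "(inf x z, z) \<in> AF'" if "(x, y) \<in> AF'" "z \<le> y" for x y z
    using that AF transfer_system_right_lifting[of K]
    unfolding AF'_def transfer_system_iff by blast
  moreover have "wide_subcategory AF'"
    using transfer_system_right_lifting[of K] W(1)
    by (auto simp: AF'_def transfer_system_iff intro: wide_subcategory_Int)
  ultimately have factorAF': "weak_factorization_system (left_lifting AF') AF'"
    by (intro weak_factorization_system_of_transfer_system) (auto simp: transfer_system_iff)
  have W_eq: "W = K O AF'"
  proof
    show "K O AF' \<subseteq> W"
      using W(1) K(3) by (auto simp: AF'_def wide_subcategory_def dest: transD)
    show "W \<subseteq> K O AF'"
    proof clarify
      fix a b assume ab: "(a, b) \<in> W"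
      then obtain x where x: "(a, x) \<in> K" "(x, b) \<in> right_lifting K"
        using weak_factorization_systemD(3)[OF factorK, of a b] W(1)
        by (auto simp: wide_subcategory_def arrows_def)
      moreover have "(a, x) \<in> arrows"
        using x(1) K(1) by (auto simp: cotransfer_system_iff wide_subcategory_def)
      ultimately have "(x, b) \<in> W"
        using W(2) ab by (auto simp: decomposable_def right_lifting_def)
      then show "(a, b) \<in> K O AF'"
        using x by (auto simp: AF'_def)
    qed
  qed
  have "K = left_lifting (right_lifting K)"
    using factorK by (rule weak_factorization_systemD)
  moreover have "left_lifting (right_lifting K) \<subseteq> left_lifting AF'"
    by (auto simp: AF'_def left_lifting_def)
  ultimately have "K \<subseteq> left_lifting AF'"
    by simp
  moreover have "two_out_of_three (K O AF')"
    using M WM by (simp add: model_structure_def flip: W_eq)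
  ultimately have "model_structure K (right_lifting K) (left_lifting AF') AF'"
    using factorK factorAF' unfolding model_structure_def by blast
  then show ?thesis
    using K(1,3) W_eq unfolding AC_set_def by blast
qed

section \<open>The largest transfer and cotransfer systems inside a wide subcategory\<close>

definition pullback_core :: "'a::lattice rel \<Rightarrow> 'a rel" where
  "pullback_core W = {(x, y). x \<le> y \<and> (\<forall>z\<le>y. (inf x z, z) \<in> W)}"

definition pushout_core :: "'a::lattice rel \<Rightarrow> 'a rel" where
  "pushout_core W = {(x, y). x \<le> y \<and> (\<forall>z\<ge>x. (z, sup y z) \<in> W)}"

lemma pullback_core_subset: "pullback_core W \<subseteq> W"
  unfolding pullback_core_def by (auto simp: inf_absorb1)

lemma pushout_core_subset: "pushout_core W \<subseteq> W"
  unfolding pushout_core_def by (auto simp: sup_absorb1)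

lemma transfer_system_subset_pullback_core:
  assumes "transfer_system T" and "T \<subseteq> W"
  shows "T \<subseteq> pullback_core W"
  using assms unfolding transfer_system_def pullback_core_def by blast

lemma cotransfer_system_subset_pushout_core:
  assumes "cotransfer_system K" and "K \<subseteq> W"
  shows "K \<subseteq> pushout_core W"
  using assms unfolding cotransfer_system_def pushout_core_def by blast

text \<open>
  The pullback of \<open>x \<rightarrow> y \<rightarrow> w\<close> along \<open>z\<close> is the pullback of \<open>x \<rightarrow> y\<close> along \<open>y \<sqinter> z\<close> followed by
  that of \<open>y \<rightarrow> w\<close> along \<open>z\<close>, so composites stay in the core.
\<close>

lemma transfer_system_pullback_core:
  fixes W :: "'a::lattice rel"
  assumes "wide_subcategory W"
  shows "transfer_system (pullback_core W)"
proof -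
  have "refl W" "trans W"
    using assms by (auto simp: wide_subcategory_def)
  have refl: "refl (pullback_core W)"
    using \<open>refl W\<close> by (auto simp: refl_on_def pullback_core_def inf_absorb2)
  have trans: "trans (pullback_core W)"
  proof (rule transI)
    fix x y w assume xy: "(x, y) \<in> pullback_core W" and yw: "(y, w) \<in> pullback_core W"
    have "(inf x z, z) \<in> W" if "z \<le> w" for z
    proof -
      have "inf x (inf y z) = inf x z"
        using xy by (simp add: pullback_core_def inf_absorb1 flip: inf.assoc)
      moreover have "(inf x (inf y z), inf y z) \<in> W" "(inf y z, z) \<in> W"
        using xy yw that by (auto simp: pullback_core_def)
      ultimately show ?thesis
        using \<open>trans W\<close> by (metis transD)
    qed
    then show "(x, w) \<in> pullback_core W"
      using xy yw by (auto simp: pullback_core_def)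
  qed
  have "(inf x z, z) \<in> pullback_core W" if "(x, y) \<in> pullback_core W" "z \<le> y" for x y z
    using that by (auto simp: pullback_core_def inf.assoc inf_absorb2)
  then show ?thesis
    using refl trans
    by (auto simp: transfer_system_iff wide_subcategory_def arrows_def pullback_core_def)
qed

lemma cotransfer_system_pushout_core:
  fixes W :: "'a::lattice rel"
  assumes "wide_subcategory W"
  shows "cotransfer_system (pushout_core W)"
proof -
  have "refl W" "trans W"
    using assms by (auto simp: wide_subcategory_def)
  have refl: "refl (pushout_core W)"
    using \<open>refl W\<close> by (auto simp: refl_on_def pushout_core_def sup_absorb2)
  have trans: "trans (pushout_core W)"
  proof (rule transI)
    fix x y w assume xy: "(x, y) \<in> pushout_core W" and yw: "(y, w) \<in> pushout_core W"
    have "(z, sup w z) \<in> W" if "x \<le> z" for z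
    proof -
      have "sup w (sup y z) = sup w z"
        using yw by (simp add: pushout_core_def sup_absorb1 flip: sup.assoc)
      moreover have "(z, sup y z) \<in> W" "(sup y z, sup w (sup y z)) \<in> W"
        using xy yw that by (auto simp: pushout_core_def)
      ultimately show ?thesis
        using \<open>trans W\<close> by (metis transD)
    qed
    then show "(x, w) \<in> pushout_core W"
      using xy yw by (auto simp: pushout_core_def)
  qed
  have "(z, sup y z) \<in> pushout_core W" if "(x, y) \<in> pushout_core W" "x \<le> z" for x y z
    using that by (auto simp: pushout_core_def sup.assoc sup_absorb2)
  then show ?thesis
    using refl trans
    by (auto simp: cotransfer_system_iff wide_subcategory_def arrows_def pushout_core_def)
qed

lemma T_max_subset_pullback_core:
  assumes "wide_subcategory W"
  shows "T_max W \<subseteq> pullback_core W"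
  unfolding T_max_def transfer_join_def
  by (rule hull_minimal)
    (use assms transfer_system_subset_pullback_core transfer_system_pullback_core in blast)+

lemma K_max_subset_pushout_core:
  assumes "wide_subcategory W"
  shows "K_max W \<subseteq> pushout_core W"
  unfolding K_max_def cotransfer_join_def
  by (rule hull_minimal)
    (use assms cotransfer_system_subset_pushout_core cotransfer_system_pushout_core in blast)+

theorem proposition4p23:
  fixes W :: "'a::{finite, lattice} rel"
  assumes "weak_equivalence_set W"
  shows "AF_max W = T_max W \<and> AC_max W = K_max W"
proof -
  obtain AC F C AF where W: "wide_subcategory W" "decomposable W"
    and M: "model_structure AC F C AF" and WM: "W = AC O AF"
    using assms by (auto simp: weak_equivalence_set_def)
  note sys = model_structure_systems[OF M, folded WM]
  have "pullback_core W \<in> AF_set W"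
    using enlarge_acyclic_fibrations[OF W M WM] sys(2,4) pullback_core_subset
      transfer_system_pullback_core[OF W(1)] transfer_system_subset_pullback_core by blast
  then have "pullback_core W \<subseteq> AF_max W"
    unfolding AF_max_def transfer_join_def by (meson Sup_upper hull_subset order.trans)
  moreover have "AF_max W \<subseteq> T_max W"
    unfolding AF_max_def T_max_def transfer_join_def
    by (rule hull_mono) (auto simp: AF_set_def)
  moreover have "pushout_core W \<in> AC_set W"
    using enlarge_acyclic_cofibrations[OF W M WM] sys(1,3) pushout_core_subset
      cotransfer_system_pushout_core[OF W(1)] cotransfer_system_subset_pushout_core by blast
  then have "pushout_core W \<subseteq> AC_max W"
    unfolding AC_max_def cotransfer_join_def by (meson Sup_upper hull_subset order.trans)
  moreover have "AC_max W \<subseteq> K_max W"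
    unfolding AC_max_def K_max_def cotransfer_join_def
    by (rule hull_mono) (auto simp: AC_set_def)
  ultimately show ?thesis
    using T_max_subset_pullback_core[OF W(1)] K_max_subset_pushout_core[OF W(1)] by blast
qed

end
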